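(* Two operators $T,\hat T\in\mathrm{Diff}_2(\mathcal Q)$ are Darboux connected if and only if they are either gauge-equivalent, or they are connected by a factorization chain.
   Context: $\mathcal Q=\mathbb C(z)$; $\mathrm{Diff}(\mathcal Q)=\mathbb C(z)[D_z]$ is the ring of linear differential operators with rational coefficients, and $\mathrm{Diff}_\rho(\mathcal Q)$ is the set of those of order exactly $\rho$. $\hat T$ is Darboux connected to $T$ if there is a nonzero operator $L\in\mathrm{Diff}(\mathcal Q)$ (of any order) such that $\hat T L=LT$. $T,\hat T$ are gauge-equivalent if there is a nonzero $\sigma\in\mathcal Q$ (viewed as a multiplication operator) such that $\hat T=\sigma T\sigma^{-1}$. $T,\hat T$ are connected by a factorization chain if there exist operators $T_i\in\mathrm{Diff}_2(\mathcal Q)$, $i=0,1,\ldots,n$, with $T_0=T$ and $T_n=\hat T$, first-order operators $A_i,B_i\in\mathrm{Diff}_1(\mathcal Q)$, $i=0,\ldots,n-1$, and constants $\lambda_i\in\mathbb C$ such that $T_i=B_iA_i+\lambda_i$ and $T_{i+1}=A_iB_i+\lambda_i$ for $i=0,\ldots,n-1$. *)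

theory Defs
  imports Complex_Main "HOL-Computational_Algebra.Computational_Algebra"
begin

type_synonym ratfun = "complex poly fract"

text \<open>The derivation $d/dz$ of the field of rational functions, given by the quotient rule;
  \<open>quotient_rule_unique\<close> shows that the value does not depend on the representation of
  \<open>f\<close> as a fraction.\<close>

definition Dz :: "ratfun \<Rightarrow> ratfun" where
  "Dz f = (THE g. \<exists>p q. q \<noteq> 0 \<and> f = Fract p q \<and> g = Fract (pderiv p * q - p * pderiv q) (q * q))"

lemma quotient_rule_unique:
  fixes a b c d :: "complex poly"
  assumes nz: "b \<noteq> 0" "d \<noteq> 0" and "Fract a b = Fract c d"
  shows "Fract (pderiv a * b - a * pderiv b) (b * b) = Fract (pderiv c * d - c * pderiv d) (d * d)"
proof -
  have e: "a * d = c * b"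
    using assms by (simp add: eq_fract)
  have "pderiv (a * d) = pderiv (c * b)"
    by (simp add: e)
  hence e': "a * pderiv d + d * pderiv a = c * pderiv b + b * pderiv c"
    by (simp add: pderiv_mult)
  have "(pderiv a * b - a * pderiv b) * (d * d) - (pderiv c * d - c * pderiv d) * (b * b)
      = (a * pderiv d + d * pderiv a - (c * pderiv b + b * pderiv c)) * (b * d)
        - (a * d - c * b) * (pderiv d * b + pderiv b * d)"
    by (simp add: algebra_simps)
  hence "(pderiv a * b - a * pderiv b) * (d * d) = (pderiv c * d - c * pderiv d) * (b * b)"
    by (simp add: e e')
  thus ?thesis
    using nz by (simp add: eq_fract)
qed

lemma Dz_Fract:
  assumes "q \<noteq> 0"
  shows "Dz (Fract p q) = Fract (pderiv p * q - p * pderiv q) (q * q)"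
  unfolding Dz_def
proof (rule the_equality)
  show "\<exists>a b. b \<noteq> 0 \<and> Fract p q = Fract a b \<and>
          Fract (pderiv p * q - p * pderiv q) (q * q) = Fract (pderiv a * b - a * pderiv b) (b * b)"
    using assms by blast
next
  fix g
  assume "\<exists>a b. b \<noteq> 0 \<and> Fract p q = Fract a b \<and> g = Fract (pderiv a * b - a * pderiv b) (b * b)"
  thus "g = Fract (pderiv p * q - p * pderiv q) (q * q)"
    using assms quotient_rule_unique by metis
qed

lemma Dz_to_fract: "Dz (to_fract p) = to_fract (pderiv p)"
  by (simp add: to_fract_def Dz_Fract)

lemma Dz_add: "Dz (f + g) = Dz f + Dz g"
proof (cases f, cases g)
  fix a b c d
  assume "f = Fract a b" "b \<noteq> 0" "g = Fract c d" "d \<noteq> 0"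
  thus ?thesis
    by (simp add: Dz_Fract eq_fract pderiv_add pderiv_mult algebra_simps)
qed

lemma Dz_mult: "Dz (f * g) = Dz f * g + f * Dz g"
proof (cases f, cases g)
  fix a b c d
  assume "f = Fract a b" "b \<noteq> 0" "g = Fract c d" "d \<noteq> 0"
  thus ?thesis
    by (simp add: Dz_Fract eq_fract pderiv_mult algebra_simps)
qed


text \<open>A differential operator is represented by its action on rational functions, so that the
  product of operators is composition. The polynomial argument of \<open>diffop\<close> only serves as
  the list of coefficients of the powers of \<open>Dz\<close>; its multiplication is not used.
  By \<open>inj_diffop\<close> below the coefficients are determined by the action, so that the order is
  well defined and an operator vanishes as a map only if all its coefficients do.\<close>

type_synonym operator = "ratfun \<Rightarrow> ratfun"

definition diffop :: "ratfun poly \<Rightarrow> operator" where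
  "diffop a = (\<lambda>f. \<Sum>i\<le>degree a. coeff a i * (Dz ^^ i) f)"

definition Diff :: "operator set" where
  "Diff = range diffop"

definition Diff_ord :: "nat \<Rightarrow> operator set" where
  "Diff_ord \<rho> = {diffop a | a. a \<noteq> 0 \<and> degree a = \<rho>}"

definition mult_op :: "ratfun \<Rightarrow> operator" where
  "mult_op \<sigma> = (\<lambda>f. \<sigma> * f)"

definition const_op :: "complex \<Rightarrow> operator" where
  "const_op c = mult_op (to_fract [:c:])"

definition add_op :: "operator \<Rightarrow> operator \<Rightarrow> operator" where
  "add_op S T = (\<lambda>f. S f + T f)"

definition darboux_connected :: "operator \<Rightarrow> operator \<Rightarrow> bool" where
  "darboux_connected T T' \<longleftrightarrow> (\<exists>L\<in>Diff. L \<noteq> (\<lambda>_. 0) \<and> T' \<circ> L = L \<circ> T)"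

definition gauge_equivalent :: "operator \<Rightarrow> operator \<Rightarrow> bool" where
  "gauge_equivalent T T' \<longleftrightarrow>
     (\<exists>\<sigma>. \<sigma> \<noteq> 0 \<and> T' = mult_op \<sigma> \<circ> T \<circ> mult_op (inverse \<sigma>))"

definition factorization_chain_connected :: "operator \<Rightarrow> operator \<Rightarrow> bool" where
  "factorization_chain_connected T T' \<longleftrightarrow>
     (\<exists>(n::nat) (Ts :: nat \<Rightarrow> operator) (A :: nat \<Rightarrow> operator) (B :: nat \<Rightarrow> operator)
        (lam :: nat \<Rightarrow> complex).
        (\<forall>i\<le>n. Ts i \<in> Diff_ord 2) \<and> Ts 0 = T \<and> Ts n = T' \<and>
        (\<forall>i<n. A i \<in> Diff_ord 1 \<and> B i \<in> Diff_ord 1 \<and>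
               Ts i = add_op (B i \<circ> A i) (const_op (lam i)) \<and>
               Ts (Suc i) = add_op (A i \<circ> B i) (const_op (lam i))))"


lemma funpow_Dz_to_fract: "(Dz ^^ i) (to_fract p) = to_fract ((pderiv ^^ i) p)"
  by (induction i) (simp_all add: Dz_to_fract)

lemma inj_diffop: "inj diffop"
proof (rule injI)
  fix a b :: "ratfun poly"
  assume eq: "diffop a = diffop b"
  have ext: "diffop c f = (\<Sum>i\<le>N. coeff c i * (Dz ^^ i) f)" if "degree c \<le> N" for c f N
    unfolding diffop_def using that
    by (intro sum.mono_neutral_left) (auto simp: coeff_eq_0)
  define N where "N = max (degree a) (degree b)"
  have "coeff a k = coeff b k" for k
  proof (induction k rule: less_induct)
    case (less k)
    define m :: "complex poly" where "m = monom 1 k"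
    have z: "(pderiv ^^ i) m = 0" if "i > k" for i
      by (rule poly_eqI)
         (use that in \<open>simp add: m_def coeff_higher_pderiv\<close>)
    have nz: "(pderiv ^^ k) m \<noteq> 0"
    proof
      assume "(pderiv ^^ k) m = 0"
      hence "coeff ((pderiv ^^ k) m) 0 = 0"
        by simp
      thus False
        by (simp add: m_def coeff_higher_pderiv pochhammer_fact[symmetric])
    qed
    have S: "diffop c (to_fract m) =
        (\<Sum>i<k. coeff c i * (Dz ^^ i) (to_fract m)) + coeff c k * to_fract ((pderiv ^^ k) m)"
      if "degree c \<le> N" for c
    proof -
      have "diffop c (to_fract m) = (\<Sum>i\<le>max N k. coeff c i * (Dz ^^ i) (to_fract m))"
        using that by (intro ext) simp
      also have "\<dots> = (\<Sum>i\<le>k. coeff c i * (Dz ^^ i) (to_fract m))"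
        by (intro sum.mono_neutral_right) (auto simp: funpow_Dz_to_fract z)
      also have "\<dots> = (\<Sum>i<k. coeff c i * (Dz ^^ i) (to_fract m))
                       + coeff c k * to_fract ((pderiv ^^ k) m)"
        by (simp add: lessThan_Suc_atMost[symmetric] funpow_Dz_to_fract)
      finally show ?thesis .
    qed
    have "(\<Sum>i<k. coeff a i * (Dz ^^ i) (to_fract m)) = (\<Sum>i<k. coeff b i * (Dz ^^ i) (to_fract m))"
      using less by (intro sum.cong) auto
    moreover have "diffop a (to_fract m) = diffop b (to_fract m)"
      by (simp add: eq)
    ultimately have "coeff a k * to_fract ((pderiv ^^ k) m) = coeff b k * to_fract ((pderiv ^^ k) m)"
      using S[of a] S[of b] by (simp add: N_def)
    thus ?case
      using nz by simp
  qed
  thus "a = b"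
    by (rule poly_eqI)
qed

end

theory Submission
  imports Defs "HOL-Computational_Algebra.Field_as_Ring"
begin

text \<open>
  The substance is that an intertwiner \<open>L\<close>, i.e. a nonzero solution of \<open>T' L = L T\<close>, can be
  factored into first-order intertwiners. Differential operators form a ring without zero
  divisors in which one can divide with remainder on the right, so every left ideal is principal
  and any two operators have a right greatest common divisor, given by a Bezout identity
  (\<open>right_division\<close>, \<open>right_gcd_exists\<close>).

  Suppose that \<open>L\<close> has positive order. In analytic terms, \<open>T\<close> maps the finite-dimensional
  solution space of \<open>L\<close> to itself and so has an eigenvector there: for some constant \<open>c\<close> the
  operators \<open>L\<close> and \<open>T - c\<close> have a common solution, and hence a common right divisor \<open>G\<close> of
  positive order. The proof below stays inside \<open>\<complex>(z)\<close>. Right multiplication by \<open>T\<close> acts on the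
  \<open>\<complex>(z)\<close>-vector space of operators modulo left multiples of \<open>L\<close>, of dimension the order of
  \<open>L\<close>. This endomorphism commutes with left multiplication by the derivation, so differentiating
  the coefficients of its monic minimal polynomial gives another annihilating polynomial of lower
  degree, which must vanish. The minimal polynomial thus has constant coefficients
  (\<open>constant_annihilating_poly_exists\<close>) and splits over \<open>\<complex>\<close>. If \<open>L\<close> were right coprime to
  \<open>T - c\<close> for every \<open>c\<close>, then \<open>L\<close> would be right coprime to the product of the linear factors,
  which is a left multiple of \<open>L\<close>; this is impossible (\<open>common_right_divisor_exists\<close>).

  Now let \<open>T\<close> have order two, and write \<open>T - c = B G\<close> and \<open>L = L1 G\<close>. With \<open>T1 = G B + c\<close> one
  gets \<open>G T = T1 G\<close>, and cancelling \<open>G\<close> shows that \<open>L1\<close> intertwines \<open>T1\<close> and \<open>T'\<close>. If \<open>G\<close> has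
  order one, this is a step of a factorization chain; if it has order two, \<open>B\<close> is a function,
  and composing \<open>L1\<close> with its inverse gives an intertwiner from \<open>T\<close> itself. Either way the order
  of the intertwiner drops, and at order zero only a gauge transformation is left
  (\<open>intertwiner_imp_chain_and_gauge\<close>). A gauge transformation after at least one step is
  absorbed by that step (\<open>darboux_step_gauge\<close>), which gives the alternative of the theorem.
\<close>

section \<open>The derivation of the rational functions\<close>

lemma Dz_0 [simp]: "Dz 0 = 0"
  using Dz_add[of 0 0] by (metis add_cancel_right_right add_0)

lemma Dz_1 [simp]: "Dz 1 = 0"
  using Dz_mult[of 1 1] by (metis add_cancel_right_right mult_1 mult_1_right)

lemma Dz_eq_0_imp_constant:
  assumes "Dz f = 0"
  shows "\<exists>c. f = to_fract [:c:]"
proof -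
  obtain p q where q: "q \<noteq> 0" and f: "f = Fract p q" and cop: "coprime p q"
  proof (cases f)
    case (Fract a b)
    obtain a' b' where "a = a' * gcd a b" "b = b' * gcd a b" "coprime a' b'"
      using gcd_coprime_exists[of a b] Fract by auto
    moreover from this Fract have "b' \<noteq> 0" by auto
    moreover have "f = Fract a' b'"
      using Fract calculation by (simp add: eq_fract) (metis mult.assoc mult.commute)
    ultimately show ?thesis using that by blast
  qed
  have e: "pderiv p * q = p * pderiv q"
    using assms q f by (simp add: Dz_Fract eq_fract Zero_fract_def)
  hence "q dvd pderiv q"
    using cop by (metis coprime_commute coprime_dvd_mult_right_iff dvd_triv_right)
  hence dq: "degree q = 0"
    using not_dvd_pderiv by blast
  hence "pderiv q = 0" by (simp add: pderiv_eq_0_iff)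
  hence "pderiv p = 0" using e q by simp
  hence "degree p = 0" by (simp add: pderiv_eq_0_iff)
  then obtain a b where "p = [:a:]" "q = [:b:]"
    using dq by (metis degree_0_id)
  hence "f = to_fract [:a / b:]"
    using q f by (simp add: to_fract_def eq_fract)
  thus ?thesis by blast
qed

section \<open>Composition in terms of coefficients\<close>

lemma diffop_eq_sum:
  "degree a \<le> N \<Longrightarrow> diffop a f = (\<Sum>i\<le>N. coeff a i * (Dz ^^ i) f)"
  unfolding diffop_def by (intro sum.mono_neutral_left) (auto simp: coeff_eq_0)

lemma diffop_add: "diffop (a + b) f = diffop a f + diffop b f"
proof -
  define N where "N = max (degree a) (degree b)"
  have "degree (a + b) \<le> N" "degree a \<le> N" "degree b \<le> N"
    unfolding N_def by (simp_all add: degree_add_le_max)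
  thus ?thesis
    by (simp add: diffop_eq_sum[of _ N] sum.distrib ring_distribs)
qed

lemma diffop_smult: "diffop (smult c a) f = c * diffop a f"
  by (simp add: diffop_eq_sum[of "smult c a" "degree a"] diffop_eq_sum[of a "degree a"]
      sum_distrib_left mult.assoc)

lemma diffop_minus: "diffop (- a) f = - diffop a f"
  using diffop_smult[of "-1" a f] by simp

lemma diffop_0 [simp]: "diffop 0 f = 0"
  by (simp add: diffop_def)

lemma diffop_sum: "diffop (sum a A) f = (\<Sum>i\<in>A. diffop (a i) f)"
  by (induction A rule: infinite_finite_induct) (simp_all add: diffop_add)

lemma Dz_sum: "Dz (sum g A) = (\<Sum>i\<in>A. Dz (g i))"
  by (induction A rule: infinite_finite_induct) (simp_all add: Dz_add)

text \<open>The coefficients of the product of the derivation with an operator whose coefficients are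
  \<open>b\<close>, by the Leibniz rule.\<close>

definition dshift :: "ratfun poly \<Rightarrow> ratfun poly" where
  "dshift b = pCons 0 b + map_poly Dz b"

lemma degree_map_poly_Dz_le: "degree (map_poly Dz b) \<le> degree b"
  by (rule degree_le) (simp add: coeff_map_poly coeff_eq_0)

lemma coeff_dshift:
  "coeff (dshift b) k = (case k of 0 \<Rightarrow> 0 | Suc j \<Rightarrow> coeff b j) + Dz (coeff b k)"
  by (simp add: dshift_def coeff_pCons coeff_map_poly)

lemma degree_dshift_le: "degree (dshift b) \<le> Suc (degree b)"
  by (rule degree_le) (auto simp: coeff_dshift coeff_eq_0 split: nat.split)

lemma diffop_dshift: "diffop (dshift b) f = Dz (diffop b f)"
proof -
  define n where "n = degree b"
  have 1: "diffop (dshift b) f = (\<Sum>i\<le>Suc n. coeff (dshift b) i * (Dz ^^ i) f)"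
    by (rule diffop_eq_sum) (simp add: n_def degree_dshift_le)
  have 2: "(\<Sum>i\<le>Suc n. Dz (coeff b i) * (Dz ^^ i) f) = (\<Sum>i\<le>n. Dz (coeff b i) * (Dz ^^ i) f)"
    by (simp add: n_def coeff_eq_0)
  have 3: "(\<Sum>i\<le>Suc n. (case i of 0 \<Rightarrow> 0 | Suc j \<Rightarrow> coeff b j) * (Dz ^^ i) f)
      = (\<Sum>i\<le>n. coeff b i * (Dz ^^ Suc i) f)"
    by (subst sum.atMost_Suc_shift) simp
  show ?thesis
    unfolding 1 coeff_dshift ring_distribs sum.distrib 2 3
    by (simp add: diffop_def Dz_sum Dz_mult sum.distrib n_def)
qed

definition skew_mult :: "ratfun poly \<Rightarrow> ratfun poly \<Rightarrow> ratfun poly" where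
  "skew_mult a b = (\<Sum>i\<le>degree a. smult (coeff a i) ((dshift ^^ i) b))"

lemma diffop_skew_mult: "diffop (skew_mult a b) = diffop a \<circ> diffop b"
proof
  fix f
  have "diffop ((dshift ^^ i) b) f = (Dz ^^ i) (diffop b f)" for i
    by (induction i) (simp_all add: diffop_dshift)
  thus "diffop (skew_mult a b) f = (diffop a \<circ> diffop b) f"
    by (simp add: skew_mult_def diffop_sum diffop_smult diffop_def[of a])
qed

lemma coeff_dshift_funpow:
  "k > degree b + i \<Longrightarrow> coeff ((dshift ^^ i) b) k = 0"
  "coeff ((dshift ^^ i) b) (degree b + i) = lead_coeff b"
proof (induction i arbitrary: k)
  case 0
  { case 1 thus ?case by (simp add: coeff_eq_0) }
  { case 2 thus ?case by simp }
next
  case (Suc i)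
  { case 1 thus ?case using Suc.IH(1) by (auto simp: coeff_dshift split: nat.split) }
  { case 2 thus ?case using Suc.IH by (simp add: coeff_dshift) }
qed

text \<open>The commutation rule of the derivation with functions only produces terms of lower order,
  so to leading order operators multiply like commutative polynomials. This makes orders additive
  and excludes zero divisors.\<close>

lemma coeff_skew_mult_degree_add:
  "coeff (skew_mult a b) (degree a + degree b) = lead_coeff a * lead_coeff b"
proof -
  have "coeff (skew_mult a b) (degree a + degree b)
      = (\<Sum>i\<le>degree a. coeff a i * coeff ((dshift ^^ i) b) (degree a + degree b))"
    by (simp add: skew_mult_def coeff_sum)
  also have "\<dots> = (\<Sum>i\<in>{degree a}. coeff a i * coeff ((dshift ^^ i) b) (degree a + degree b))"
    by (rule sum.mono_neutral_right) (auto simp: coeff_dshift_funpow(1))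
  also have "\<dots> = lead_coeff a * lead_coeff b"
    using coeff_dshift_funpow(2)[of "degree a" b] by (simp add: add.commute)
  finally show ?thesis .
qed

lemma degree_skew_mult:
  assumes "a \<noteq> 0" "b \<noteq> 0"
  shows "skew_mult a b \<noteq> 0" "degree (skew_mult a b) = degree a + degree b"
proof -
  have nz: "coeff (skew_mult a b) (degree a + degree b) \<noteq> 0"
    using assms by (simp add: coeff_skew_mult_degree_add)
  thus "skew_mult a b \<noteq> 0" by auto
  have "degree (skew_mult a b) \<le> degree a + degree b"
    by (rule degree_le) (auto simp: skew_mult_def coeff_sum coeff_dshift_funpow(1))
  thus "degree (skew_mult a b) = degree a + degree b"
    using le_degree[OF nz] by simp
qed

section \<open>The ring of differential operators\<close>

lemma diffop_in_Diff [simp]: "diffop a \<in> Diff"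
  by (simp add: Diff_def)

text \<open>A type of its own for the differential operators allows composition to be the
  multiplication of a ring, so that the algebraic laws and their automation apply.\<close>

typedef dop = Diff morphisms act Op
  by (auto simp: Diff_def)

setup_lifting type_definition_dop

definition symbol :: "dop \<Rightarrow> ratfun poly" where
  "symbol P = inv diffop (act P)"

lemma diffop_symbol: "diffop (symbol P) = act P"
  using act[of P] unfolding symbol_def Diff_def by (rule f_inv_into_f)

lemma symbol_unique: "(\<And>f. diffop a f = act P f) \<Longrightarrow> symbol P = a"
  using inj_diffop diffop_symbol[of P] by (metis ext injD)

lemma act_eqI: "(\<And>f. act P f = act Q f) \<Longrightarrow> P = Q"
  by (simp add: act_inject[symmetric] fun_eq_iff)

lemma mult_op_in_Diff: "mult_op c \<in> Diff"
proof -
  have "mult_op c = diffop [:c:]" by (simp add: fun_eq_iff mult_op_def diffop_def)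
  thus ?thesis by simp
qed

lemma act_add: "act P (f + g) = act P f + act P g"
proof -
  have "(Dz ^^ i) (f + g) = (Dz ^^ i) f + (Dz ^^ i) g" for i
    by (induction i) (simp_all add: Dz_add)
  thus ?thesis
    unfolding diffop_symbol[symmetric] by (simp add: diffop_def ring_distribs sum.distrib)
qed

instantiation dop :: ring_1
begin

lift_definition zero_dop :: dop is "\<lambda>_. 0"
proof -
  have "(\<lambda>_. 0) = diffop 0" by auto
  thus "(\<lambda>_. 0) \<in> Diff" by (metis diffop_in_Diff)
qed

lift_definition one_dop :: dop is "\<lambda>f. f"
  using mult_op_in_Diff[of 1] by (simp add: mult_op_def)

lift_definition plus_dop :: "dop \<Rightarrow> dop \<Rightarrow> dop" is "\<lambda>P Q f. P f + Q f"
proof -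
  fix P Q assume "P \<in> Diff" "Q \<in> Diff"
  then obtain a b where "P = diffop a" "Q = diffop b" by (auto simp: Diff_def)
  hence "(\<lambda>f. P f + Q f) = diffop (a + b)" by (simp add: fun_eq_iff diffop_add)
  thus "(\<lambda>f. P f + Q f) \<in> Diff" by simp
qed

lift_definition uminus_dop :: "dop \<Rightarrow> dop" is "\<lambda>P f. - P f"
proof -
  fix P assume "P \<in> Diff"
  then obtain a where "P = diffop a" by (auto simp: Diff_def)
  hence "(\<lambda>f. - P f) = diffop (- a)" by (simp add: fun_eq_iff diffop_minus)
  thus "(\<lambda>f. - P f) \<in> Diff" by simp
qed

definition minus_dop :: "dop \<Rightarrow> dop \<Rightarrow> dop" where "P - Q = P + - Q" for P Q :: dop

lift_definition times_dop :: "dop \<Rightarrow> dop \<Rightarrow> dop" is "\<lambda>P Q. P \<circ> Q"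
proof -
  fix P Q assume "P \<in> Diff" "Q \<in> Diff"
  then obtain a b where "P = diffop a" "Q = diffop b" by (auto simp: Diff_def)
  thus "P \<circ> Q \<in> Diff" by (simp flip: diffop_skew_mult)
qed

instance
proof
  fix P Q R :: dop
  show "P * Q * R = P * (Q * R)" "1 * P = P" "P * 1 = P" "P + Q + R = P + (Q + R)"
    "P + Q = Q + P" "0 + P = P" "- P + P = 0" "(P + Q) * R = P * R + Q * R"
    by (transfer; simp add: fun_eq_iff algebra_simps)+
  show "P - Q = P + - Q" by (simp add: minus_dop_def)
  show "P * (Q + R) = P * Q + P * R"
    by (rule act_eqI) (simp add: times_dop.rep_eq plus_dop.rep_eq act_add)
  have "act (0 :: dop) 1 \<noteq> act 1 1" by (simp add: zero_dop.rep_eq one_dop.rep_eq)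
  thus "(0 :: dop) \<noteq> 1" by metis
qed

end

lift_definition scal :: "ratfun \<Rightarrow> dop" is mult_op
  by (rule mult_op_in_Diff)

lift_definition D :: dop is Dz
proof -
  have "diffop [:0, 1:] = Dz" by (simp add: fun_eq_iff diffop_def)
  thus "Dz \<in> Diff" by (metis diffop_in_Diff)
qed

lemma act_scal: "act (scal c) f = c * f"
  by (simp add: scal.rep_eq mult_op_def)

lemma scal_hom:
  "scal 0 = 0" "scal 1 = 1" "scal (c + d) = scal c + scal d" "scal (c * d) = scal c * scal d"
  by (rule act_eqI, simp add: act_scal zero_dop.rep_eq one_dop.rep_eq plus_dop.rep_eq
      times_dop.rep_eq algebra_simps)+

lemma D_scal: "D * scal c = scal (Dz c) + scal c * D"
  by (rule act_eqI) (simp add: act_scal plus_dop.rep_eq times_dop.rep_eq D.rep_eq Dz_mult)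

lemma symbol_hom:
  "symbol 0 = 0" "symbol (P + Q) = symbol P + symbol Q" "symbol (- P) = - symbol P"
  "symbol (P - Q) = symbol P - symbol Q" "symbol (P * Q) = skew_mult (symbol P) (symbol Q)"
proof -
  have m: "symbol (- P) = - symbol P" for P
    by (rule symbol_unique) (simp add: diffop_minus diffop_symbol uminus_dop.rep_eq)
  have p: "symbol (P + Q) = symbol P + symbol Q" for P Q
    by (rule symbol_unique) (simp add: diffop_add diffop_symbol plus_dop.rep_eq)
  show "symbol (- P) = - symbol P" "symbol (P + Q) = symbol P + symbol Q"
    by (fact m p)+
  show "symbol (P - Q) = symbol P - symbol Q"
    unfolding minus_dop_def m p by simp
  show "symbol 0 = 0"
    by (rule symbol_unique) (simp add: zero_dop.rep_eq)
  show "symbol (P * Q) = skew_mult (symbol P) (symbol Q)"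
    by (rule symbol_unique) (simp add: diffop_skew_mult diffop_symbol times_dop.rep_eq)
qed

lemma symbol_scal [simp]: "symbol (scal c) = [:c:]"
  by (rule symbol_unique) (simp add: diffop_def act_scal)

lemma symbol_inject: "symbol P = symbol Q \<longleftrightarrow> P = Q"
  by (metis act_inject diffop_symbol)

lemma symbol_eq_0_iff [simp]: "symbol P = 0 \<longleftrightarrow> P = 0"
  using symbol_inject[of P 0] by (simp add: symbol_hom)

lemma symbol_scal_mult: "symbol (scal c * P) = smult c (symbol P)"
  by (simp add: symbol_hom skew_mult_def)

lemma symbol_sum: "symbol (sum P A) = (\<Sum>i\<in>A. symbol (P i))"
  by (induction A rule: infinite_finite_induct) (simp_all add: symbol_hom)

definition dop_order :: "dop \<Rightarrow> nat" where
  "dop_order P = degree (symbol P)"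

instance dop :: ring_1_no_zero_divisors
proof
  fix P Q :: dop assume "P \<noteq> 0" "Q \<noteq> 0"
  hence "symbol (P * Q) \<noteq> 0" by (simp add: symbol_hom degree_skew_mult)
  thus "P * Q \<noteq> 0" by simp
qed

lemma order_mult: "P \<noteq> 0 \<Longrightarrow> Q \<noteq> 0 \<Longrightarrow> dop_order (P * Q) = dop_order P + dop_order Q"
  by (simp add: dop_order_def symbol_hom degree_skew_mult)

lemma scal_eq_0_iff [simp]: "scal c = 0 \<longleftrightarrow> c = 0"
  by (simp flip: symbol_eq_0_iff)

lemma order_scal [simp]: "dop_order (scal c) = 0"
  by (simp add: dop_order_def)

lemma order_0_scal:
  assumes "dop_order P = 0" obtains c where "P = scal c"
proof -
  obtain c where "symbol P = [:c:]" using assms unfolding dop_order_def by (metis degree_0_id)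
  thus ?thesis using that symbol_inject by (metis symbol_scal)
qed

lemma scal_inverse:
  "c \<noteq> 0 \<Longrightarrow> scal (inverse c) * scal c = 1"
  "c \<noteq> 0 \<Longrightarrow> scal c * scal (inverse c) = 1"
  by (simp_all flip: scal_hom)

text \<open>The free bound \<open>n\<close> lets all remainders modulo an operator of order \<open>n\<close>, zero included, be
  expanded in the same powers of \<open>D\<close>.\<close>

lemma dop_eq_sum:
  assumes "\<And>i. i \<ge> n \<Longrightarrow> coeff (symbol P) i = 0"
  shows "P = (\<Sum>i<n. scal (coeff (symbol P) i) * D ^ i)"
proof (rule act_eqI)
  fix f
  have a: "act (sum Q A) f = (\<Sum>i\<in>A. act (Q i) f)" for Q and A :: "nat set"
    by (induction A rule: infinite_finite_induct) (simp_all add: zero_dop.rep_eq plus_dop.rep_eq)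
  have d: "act (D ^ i) f = (Dz ^^ i) f" for i
    by (induction i) (simp_all add: one_dop.rep_eq times_dop.rep_eq D.rep_eq)
  have "act P f = (\<Sum>i\<le>dop_order P + n. coeff (symbol P) i * (Dz ^^ i) f)"
    unfolding diffop_symbol[symmetric] by (rule diffop_eq_sum) (simp add: dop_order_def)
  also have "\<dots> = (\<Sum>i<n. coeff (symbol P) i * (Dz ^^ i) f)"
    by (rule sum.mono_neutral_right) (auto intro: assms)
  finally show "act P f = act (\<Sum>i<n. scal (coeff (symbol P) i) * D ^ i) f"
    by (simp add: a times_dop.rep_eq act_scal d)
qed

section \<open>Right division and right divisors\<close>

text \<open>The remainder is bounded through its coefficients because the zero operator has
  \<open>dop_order\<close> zero: when \<open>L\<close> has order zero, the condition says that the remainder vanishes.\<close>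

lemma right_division:
  assumes "L \<noteq> 0"
  shows "\<exists>A R. P = A * L + R \<and> (\<forall>i\<ge>dop_order L. coeff (symbol R) i = 0)"
proof -
  have "\<exists>A R. P = A * L + R \<and> (\<forall>i\<ge>dop_order L. coeff (symbol R) i = 0)"
    if "\<forall>i\<ge>N. coeff (symbol P) i = 0" for N P
    using that
  proof (induction N arbitrary: P)
    case 0
    thus ?case by (intro exI[of _ 0] exI[of _ P]) simp
  next
    case (Suc N)
    show ?case
    proof (cases "N < dop_order L")
      case True
      thus ?thesis using Suc.prems by (intro exI[of _ 0] exI[of _ P]) simp
    next
      case False
      \<comment> \<open>\<open>C * L\<close> has the same coefficient as \<open>P\<close> at \<open>N\<close>, and none above.\<close>
      define C where "C = scal (coeff (symbol P) N / lead_coeff (symbol L)) * D ^ (N - dop_order L)"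
      have "symbol (D * Q) = dshift (symbol Q)" for Q
        by (rule symbol_unique) (simp add: diffop_dshift times_dop.rep_eq D.rep_eq diffop_symbol)
      hence s: "symbol (D ^ k * Q) = (dshift ^^ k) (symbol Q)" for k Q
        by (induction k) (simp_all add: mult.assoc)
      have sc: "symbol (C * L) = smult (coeff (symbol P) N / lead_coeff (symbol L))
                  ((dshift ^^ (N - dop_order L)) (symbol L))"
        unfolding C_def mult.assoc symbol_scal_mult s ..
      have "coeff (symbol (C * L)) N = coeff (symbol P) N"
        using coeff_dshift_funpow(2)[of "N - dop_order L" "symbol L"] False assms
        by (simp add: sc dop_order_def)
      moreover have "coeff (symbol (C * L)) i = 0" if "i > N" for i
        using coeff_dshift_funpow(1)[of "symbol L" "N - dop_order L" i] False that
        by (simp add: sc dop_order_def)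
      ultimately have "\<forall>i\<ge>N. coeff (symbol (P - C * L)) i = 0"
        using Suc.prems by (auto simp: symbol_hom) (metis Suc_leI diff_0_right le_neq_implies_less)
      from Suc.IH[OF this] obtain A R
        where "P - C * L = A * L + R" "\<forall>i\<ge>dop_order L. coeff (symbol R) i = 0" by blast
      thus ?thesis
        by (intro exI[of _ "A + C"] exI[of _ R]) (simp add: algebra_simps)
    qed
  qed
  moreover have "\<forall>i\<ge>Suc (dop_order P). coeff (symbol P) i = 0"
    by (auto simp: dop_order_def coeff_eq_0)
  ultimately show ?thesis by blast
qed

definition rdvd :: "dop \<Rightarrow> dop \<Rightarrow> bool" where
  "rdvd G P \<longleftrightarrow> (\<exists>A. P = A * G)"

lemma rdvd_0 [simp]: "rdvd G 0"
  by (auto simp: rdvd_def intro: exI[of _ 0])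

lemma rdvd_refl [simp]: "rdvd G G"
  by (auto simp: rdvd_def intro: exI[of _ 1])

lemma rdvd_mult_left: "rdvd G P \<Longrightarrow> rdvd G (Q * P)"
  unfolding rdvd_def by (metis mult.assoc)

lemma rdvd_add: "rdvd G P \<Longrightarrow> rdvd G Q \<Longrightarrow> rdvd G (P + Q)"
  unfolding rdvd_def by (metis distrib_right)

lemma rdvd_diff: "rdvd G P \<Longrightarrow> rdvd G Q \<Longrightarrow> rdvd G (P - Q)"
  unfolding rdvd_def by (metis left_diff_distrib)

lemma rdvd_sum: "(\<And>i. i \<in> A \<Longrightarrow> rdvd G (P i)) \<Longrightarrow> rdvd G (sum P A)"
  by (induction A rule: infinite_finite_induct) (auto intro: rdvd_add)

lemma rdvd_order_le: "rdvd G P \<Longrightarrow> P \<noteq> 0 \<Longrightarrow> dop_order G \<le> dop_order P"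
  unfolding rdvd_def by (auto simp: order_mult)

text \<open>A nonzero element of least order in the left ideal generated by \<open>X\<close> and \<open>Y\<close> divides every
  element of that ideal, since the remainder of a division would be of smaller order.\<close>

lemma right_gcd_exists:
  assumes "X \<noteq> 0"
  shows "\<exists>G U V. G \<noteq> 0 \<and> rdvd G X \<and> rdvd G Y \<and> G = U * X + V * Y"
proof -
  define J where "J = {P. \<exists>U V. P = U * X + V * Y}"
  have J_diff: "P - A * Q \<in> J" if "P \<in> J" "Q \<in> J" for P Q A
  proof -
    from that obtain U V U' V' where "P = U * X + V * Y" "Q = U' * X + V' * Y"
      by (auto simp: J_def)
    hence "P - A * Q = (U - A * U') * X + (V - A * V') * Y" by (simp add: algebra_simps)
    thus ?thesis unfolding J_def by blast
  qed
  have "X = 1 * X + 0 * Y" "Y = 0 * X + 1 * Y" by simp_all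
  hence XY: "X \<in> J" "Y \<in> J" unfolding J_def by blast+
  obtain G where G: "G \<in> J" "G \<noteq> 0" and min: "\<And>P. P \<in> J \<Longrightarrow> P \<noteq> 0 \<Longrightarrow> dop_order G \<le> dop_order P"
    using ex_has_least_nat[of "\<lambda>P. P \<in> J \<and> P \<noteq> 0" X dop_order] assms XY by auto
  have "rdvd G P" if "P \<in> J" for P
  proof -
    obtain A R where PR: "P = A * G + R" and R: "\<forall>i\<ge>dop_order G. coeff (symbol R) i = 0"
      using right_division[OF G(2)] by blast
    have "R \<in> J" using J_diff[OF that G(1), of A] PR by simp
    moreover have "R \<noteq> 0 \<Longrightarrow> dop_order R < dop_order G"
      using R by (metis leading_coeff_0_iff linorder_not_less dop_order_def symbol_eq_0_iff)
    ultimately have "R = 0" using min by force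
    thus ?thesis using PR by (auto simp: rdvd_def)
  qed
  thus ?thesis using G XY unfolding J_def by blast
qed

section \<open>A constant polynomial relation\<close>

text \<open>More vectors than coordinates are linearly dependent. In the induction a vector \<open>v k\<close> with
  a nonzero coordinate at the new index is used as a pivot to clear that coordinate in the
  others, which \<open>s\<close> renumbers.\<close>

lemma linear_dependence:
  fixes v :: "nat \<Rightarrow> 'b \<Rightarrow> 'k :: field"
  assumes "finite B"
  shows "\<exists>c. (\<exists>i\<le>card B. c i \<noteq> 0) \<and> (\<forall>b\<in>B. (\<Sum>i\<le>card B. c i * v i b) = 0)"
  using assms
proof (induction B arbitrary: v)
  case empty
  show ?case by (rule exI[of _ "\<lambda>_. 1"]) simp
next
  case (insert x B)
  let ?n = "card B"
  have card: "card (insert x B) = Suc ?n" using insert by simp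
  show ?case
  proof (cases "\<exists>k\<le>Suc ?n. v k x \<noteq> 0")
    case False
    obtain c where c: "\<exists>i\<le>?n. c i \<noteq> 0" "\<forall>b\<in>B. (\<Sum>i\<le>?n. c i * v i b) = 0"
      using insert.IH by blast
    show ?thesis
      unfolding card using c False
      by (intro exI[of _ "\<lambda>i. if i \<le> ?n then c i else 0"]) (auto intro!: sum.neutral)
  next
    case True
    then obtain k where k: "k \<le> Suc ?n" "v k x \<noteq> 0" by blast
    define s where "s = (\<lambda>i. if i < k then i else Suc i)"
    have s: "bij_betw s {..?n} ({..Suc ?n} - {k})"
      by (rule bij_betw_byWitness[of _ "\<lambda>i. if i < k then i else i - 1"])
         (use k in \<open>auto simp: s_def\<close>)
    define w where "w = (\<lambda>i b. v (s i) b - v (s i) x / v k x * v k b)"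
    obtain c where c: "\<exists>i\<le>?n. c i \<noteq> 0" "\<forall>b\<in>B. (\<Sum>i\<le>?n. c i * w i b) = 0"
      using insert.IH by blast
    define c' where "c' = (\<lambda>j. if j = k then - (\<Sum>i\<le>?n. c i * (v (s i) x / v k x))
                               else c (the_inv_into {..?n} s j))"
    have c's: "c' (s i) = c i" if "i \<le> ?n" for i
    proof -
      have "s i \<noteq> k" by (auto simp: s_def)
      thus ?thesis
        using that s by (simp add: c'_def the_inv_into_f_f bij_betw_def)
    qed
    have sum: "(\<Sum>j\<le>Suc ?n. c' j * v j b) = (\<Sum>i\<le>?n. c i * w i b)" for b
    proof -
      have "(\<Sum>j\<le>Suc ?n. c' j * v j b) = c' k * v k b + (\<Sum>j\<in>{..Suc ?n} - {k}. c' j * v j b)"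
        using k by (subst sum.remove[of _ k]) auto
      also have "(\<Sum>j\<in>{..Suc ?n} - {k}. c' j * v j b) = (\<Sum>i\<le>?n. c' (s i) * v (s i) b)"
        by (rule sum.reindex_bij_betw[OF s, symmetric])
      also have "\<dots> = (\<Sum>i\<le>?n. c i * v (s i) b)"
        by (intro sum.cong) (simp_all add: c's)
      finally show ?thesis
        by (simp add: c'_def w_def algebra_simps sum_subtractf sum_distrib_left)
    qed
    have "w i x = 0" for i using k by (simp add: w_def)
    hence "\<forall>b\<in>insert x B. (\<Sum>j\<le>Suc ?n. c' j * v j b) = 0"
      unfolding sum using c(2) by simp
    moreover obtain i where "i \<le> ?n" "c i \<noteq> 0" using c(1) by blast
    hence "c' (s i) \<noteq> 0" "s i \<le> Suc ?n" by (simp_all add: c's) (simp add: s_def)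
    ultimately show ?thesis unfolding card by blast
  qed
qed

text \<open>The polynomial \<open>m\<close> evaluated at the map \<open>X \<mapsto> X * T\<close> and applied to \<open>P\<close>. Powers of \<open>T\<close> stay
  on the right and coefficients on the left, so the coefficients may be functions that do not
  commute with \<open>T\<close>.\<close>

definition right_eval :: "dop \<Rightarrow> ratfun poly \<Rightarrow> dop \<Rightarrow> dop" where
  "right_eval T m P = (\<Sum>i\<le>degree m. scal (coeff m i) * P * T ^ i)"

lemma right_eval_eq_sum:
  "degree m \<le> N \<Longrightarrow> right_eval T m P = (\<Sum>i\<le>N. scal (coeff m i) * P * T ^ i)"
  unfolding right_eval_def by (intro sum.mono_neutral_left) (auto simp: coeff_eq_0 scal_hom)

lemma right_eval_add: "right_eval T m (P + Q) = right_eval T m P + right_eval T m Q"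
  by (simp add: right_eval_def algebra_simps sum.distrib)

lemma right_eval_scal: "right_eval T m (scal c * P) = scal c * right_eval T m P"
proof -
  have "scal a * (scal c * X) = scal c * (scal a * X)" for a X
    by (simp flip: mult.assoc scal_hom add: mult.commute)
  thus ?thesis by (simp add: right_eval_def sum_distrib_left mult.assoc)
qed

lemma right_eval_sum: "right_eval T m (sum P A) = (\<Sum>i\<in>A. right_eval T m (P i))"
proof -
  have "right_eval T m 0 = 0" by (simp add: right_eval_def)
  thus ?thesis
    by (induction A rule: infinite_finite_induct) (simp_all add: right_eval_add)
qed

lemma right_eval_smult: "right_eval T (smult c m) P = scal c * right_eval T m P"
  by (simp add: right_eval_eq_sum[of "smult c m" "degree m"] right_eval_def sum_distrib_left
      scal_hom mult.assoc)

text \<open>Left multiplication by \<open>D\<close> commutes with right multiplication by \<open>T\<close>; its commutator with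
  a polynomial in the latter therefore only sees the coefficients, which it differentiates.\<close>

lemma right_eval_Dz:
  "right_eval T (map_poly Dz m) P = D * right_eval T m P - right_eval T m (D * P)"
proof -
  have "degree (map_poly Dz m) \<le> degree m" by (rule degree_map_poly_Dz_le)
  moreover have "D * (scal c * P * X) - scal c * (D * P) * X = scal (Dz c) * P * X" for c X
  proof -
    have "D * (scal c * P * X) = (D * scal c) * P * X" by (simp add: mult.assoc)
    thus ?thesis by (simp add: D_scal algebra_simps)
  qed
  ultimately show ?thesis
    by (simp add: right_eval_eq_sum[of _ "degree m"] sum_distrib_left flip: sum_subtractf)
       (simp add: coeff_map_poly)
qed

lemma intertwining_power:
  assumes "T' * L = L * (T :: dop)"
  shows "L * T ^ i = T' ^ i * L"
proof (induction i)
  case (Suc i)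
  have "L * T ^ Suc i = T' * (L * T ^ i)" using assms by (simp flip: mult.assoc)
  thus ?case by (simp add: Suc mult.assoc)
qed simp

text \<open>Operators modulo left multiples of \<open>L\<close> are spanned over \<open>\<complex>(z)\<close> by the powers \<open>D ^ j\<close> below
  the order \<open>n\<close> of \<open>L\<close>. An endomorphism of such a space has \<open>n * n\<close> matrix entries, so its
  powers are linearly dependent. The intertwining relation is what makes right multiplication by
  \<open>T\<close> well defined modulo left multiples of \<open>L\<close>.\<close>

lemma annihilating_poly_exists:
  assumes L: "L \<noteq> 0" and LT: "T' * L = L * T"
  shows "\<exists>m. m \<noteq> 0 \<and> (\<forall>P. rdvd L (right_eval T m P))"
proof -
  let ?n = "dop_order L"
  let ?B = "{..<?n} \<times> {..<?n}"
  have "\<exists>R. rdvd L (D ^ j * T ^ i - R) \<and> (\<forall>k\<ge>?n. coeff (symbol R) k = 0)" for i j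
    using right_division[OF L, of "D ^ j * T ^ i"] unfolding rdvd_def
    by (metis add_diff_cancel_right')
  hence "\<forall>i j. \<exists>R. rdvd L (D ^ j * T ^ i - R) \<and> (\<forall>k\<ge>?n. coeff (symbol R) k = 0)"
    by blast
  then obtain R where "\<forall>i j. rdvd L (D ^ j * T ^ i - R i j) \<and>
      (\<forall>k\<ge>?n. coeff (symbol (R i j)) k = 0)"
    by (subst (asm) choice_iff, subst (asm) choice_iff) blast
  hence R: "rdvd L (D ^ j * T ^ i - R i j)"
    and R0: "k \<ge> ?n \<Longrightarrow> coeff (symbol (R i j)) k = 0" for i j k
    by blast+
  obtain c where c: "\<exists>i\<le>card ?B. c i \<noteq> 0"
    "\<forall>b\<in>?B. (\<Sum>i\<le>card ?B. c i * (\<lambda>(j, k). coeff (symbol (R i j)) k) b) = 0"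
    using linear_dependence[of ?B "\<lambda>i (j, k). coeff (symbol (R i j)) k"] by auto
  let ?N = "card ?B"
  define m where "m = (\<Sum>i\<le>?N. monom (c i) i)"
  have cm: "coeff m i = (if i \<le> ?N then c i else 0)" for i
    by (simp add: m_def coeff_sum)
  have "m \<noteq> 0" using c(1) cm by (metis coeff_0)
  have deg: "degree m \<le> ?N" by (rule degree_le) (simp add: cm)
  \<comment> \<open>The relation \<open>c\<close> holds between the remainders, hence between the powers modulo \<open>L\<close>.\<close>
  have basis: "rdvd L (right_eval T m (D ^ j))" if "j < ?n" for j
  proof -
    have "coeff (symbol (\<Sum>i\<le>?N. scal (c i) * R i j)) k = 0" for k
    proof (cases "k < ?n")
      case True
      thus ?thesis using c(2) that by (auto simp: symbol_sum symbol_scal_mult coeff_sum)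
    qed (simp add: symbol_sum symbol_scal_mult coeff_sum R0)
    hence "(\<Sum>i\<le>?N. scal (c i) * R i j) = 0"
      by (metis poly_eqI coeff_0 symbol_eq_0_iff)
    hence "right_eval T m (D ^ j) = (\<Sum>i\<le>?N. scal (c i) * (D ^ j * T ^ i - R i j))"
      by (simp add: right_eval_eq_sum[OF deg] cm right_diff_distrib sum_subtractf mult.assoc)
    thus ?thesis by (simp add: rdvd_sum rdvd_mult_left R)
  qed
  have "rdvd L (right_eval T m P)" for P
  proof -
    obtain A Q where P: "P = A * L + Q" and Q: "\<forall>i\<ge>?n. coeff (symbol Q) i = 0"
      using right_division[OF L] by blast
    have "rdvd L (right_eval T m (A * L))"
      unfolding right_eval_def
      by (intro rdvd_sum) (simp add: mult.assoc intertwining_power[OF LT] rdvd_mult_left)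
    moreover have "Q = (\<Sum>i<?n. scal (coeff (symbol Q) i) * D ^ i)"
      using Q by (intro dop_eq_sum) auto
    hence "rdvd L (right_eval T m Q)"
      by (metis (no_types, lifting) basis lessThan_iff rdvd_mult_left rdvd_sum right_eval_scal
          right_eval_sum)
    ultimately show ?thesis by (simp add: P right_eval_add rdvd_add)
  qed
  thus ?thesis using \<open>m \<noteq> 0\<close> by blast
qed

abbreviation const :: "complex \<Rightarrow> dop" where
  "const c \<equiv> scal (to_fract [:c:])"

definition eval_at :: "dop \<Rightarrow> complex poly \<Rightarrow> dop" where
  "eval_at T p = (\<Sum>i\<le>degree p. const (coeff p i) * T ^ i)"

text \<open>Differentiating the coefficients of an annihilating polynomial gives an annihilating
  polynomial. A monic one loses its leading term, so for one of least degree the derivative is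
  zero and the coefficients are constants. Applying it to the operator \<open>1\<close> yields a polynomial
  in \<open>T\<close>.\<close>

lemma constant_annihilating_poly_exists:
  assumes L: "L \<noteq> 0" and LT: "T' * L = L * T"
  shows "\<exists>p. p \<noteq> 0 \<and> rdvd L (eval_at T p)"
proof -
  define I where "I = {m. m \<noteq> 0 \<and> (\<forall>P. rdvd L (right_eval T m P))}"
  obtain m where mI: "m \<in> I" and min: "\<And>m'. m' \<in> I \<Longrightarrow> degree m \<le> degree m'"
    using ex_has_least_nat[of "\<lambda>m. m \<in> I" _ degree] annihilating_poly_exists[OF assms]
    unfolding I_def by blast
  define q where "q = smult (inverse (lead_coeff m)) m"
  have m0: "m \<noteq> 0" using mI by (simp add: I_def)
  have qI: "q \<in> I"
    using mI m0 by (simp add: I_def q_def right_eval_smult rdvd_mult_left)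
  have deg: "degree q = degree m" and lead: "coeff q (degree q) = 1"
    using m0 by (simp_all add: q_def)
  have "map_poly Dz q = 0"
  proof (rule ccontr)
    assume nz: "map_poly Dz q \<noteq> 0"
    have "rdvd L (right_eval T (map_poly Dz q) P)" for P
      unfolding right_eval_Dz using qI by (intro rdvd_diff rdvd_mult_left) (auto simp: I_def)
    hence "degree q \<le> degree (map_poly Dz q)"
      using nz min deg by (simp add: I_def)
    hence "degree (map_poly Dz q) = degree q" using degree_map_poly_Dz_le[of q] by simp
    hence "lead_coeff (map_poly Dz q) = 0" using lead by (simp add: coeff_map_poly)
    thus False using nz by simp
  qed
  hence "Dz (coeff q i) = 0" for i
    by (metis Dz_0 coeff_0 coeff_map_poly)
  hence "\<exists>c. coeff q i = to_fract [:c:]" for i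
    by (rule Dz_eq_0_imp_constant)
  then obtain c where c: "\<And>i. coeff q i = to_fract [:c i:]" by metis
  define p where "p = (\<Sum>i\<le>degree q. monom (c i) i)"
  have c0: "c i = 0" if "i > degree q" for i
    using c[of i] that by (simp add: coeff_eq_0)
  have cp: "coeff p i = c i" for i
    using c0[of i] by (auto simp: p_def coeff_sum not_le)
  have "c (degree q) \<noteq> 0" using lead c[of "degree q"] by auto
  hence p0: "p \<noteq> 0" and dp: "degree p = degree q"
    using le_degree[of p "degree q"] degree_le[of "degree q" p] c0 cp by (auto simp: le_antisym)
  have "eval_at T p = right_eval T q 1"
    by (simp add: eval_at_def right_eval_def dp cp c)
  thus ?thesis using qI p0 by (auto simp: I_def)
qed

lemma const_hom: "const (a + b) = const a + const b" "const (a * b) = const a * const b"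
  "const 0 = 0" "const 1 = 1"
proof -
  have "to_fract [:a + b:] = to_fract [:a:] + to_fract [:b:]"
    by (simp flip: to_fract_add)
  moreover have "to_fract [:a * b:] = to_fract [:a:] * to_fract [:b:]"
    by (simp flip: to_fract_mult)
  ultimately show "const (a + b) = const a + const b" "const (a * b) = const a * const b"
    "const 0 = 0" "const 1 = 1"
    by (simp_all add: scal_hom flip: one_pCons)
qed

lemma const_uminus: "const (- c) = - const c"
proof -
  have "const (- c) + const c = const (- c + c)" by (rule const_hom(1)[symmetric])
  also have "\<dots> = 0" by (simp add: scal_hom)
  finally show ?thesis by (simp add: eq_neg_iff_add_eq_0)
qed

lemma const_commute: "const c * P = P * const c"
proof -
  have D: "D ^ i * const c = const c * D ^ i" for i
  proof (induction i)
    case (Suc i)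
    have "D * const c = const c * D"
      by (simp add: D_scal Dz_to_fract pderiv_pCons scal_hom)
    thus ?case using Suc by (metis mult.assoc power_Suc)
  qed simp
  have s: "scal a * const c = const c * scal a" for a
    by (simp flip: scal_hom add: mult.commute)
  have P: "P = (\<Sum>i<Suc (dop_order P). scal (coeff (symbol P) i) * D ^ i)"
    by (rule dop_eq_sum) (simp add: dop_order_def coeff_eq_0)
  have "const c * (scal a * D ^ i) = (scal a * D ^ i) * const c" for a i
    by (simp only: mult.assoc D) (simp only: mult.assoc[symmetric] s)
  hence "const c * (\<Sum>i<Suc (dop_order P). scal (coeff (symbol P) i) * D ^ i)
      = (\<Sum>i<Suc (dop_order P). scal (coeff (symbol P) i) * D ^ i) * const c"
    by (simp only: sum_distrib_left sum_distrib_right)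
  thus ?thesis by (simp only: P[symmetric])
qed

lemma eval_at_linear_factor: "eval_at T ([:- c, 1:] * p) = eval_at T p * (T - const c)"
proof -
  let ?n = "Suc (degree p)"
  have ev: "eval_at T r = (\<Sum>i\<le>k. const (coeff r i) * T ^ i)" if "degree r \<le> k" for r k
    unfolding eval_at_def using that
    by (intro sum.mono_neutral_left) (auto simp: coeff_eq_0 const_hom)
  have cf: "coeff ([:- c, 1:] * p) i = (case i of 0 \<Rightarrow> 0 | Suc j \<Rightarrow> coeff p j) + (- c) * coeff p i" for i
    by (simp add: coeff_pCons split: nat.split)
  have "degree ([:- c, 1:] * p) \<le> ?n"
    using degree_mult_le[of "[:- c, 1:]" p] by simp
  hence "eval_at T ([:- c, 1:] * p) = (\<Sum>i\<le>?n. const (coeff ([:- c, 1:] * p) i) * T ^ i)"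
    by (rule ev)
  also have "\<dots> = (\<Sum>i\<le>?n. const (case i of 0 \<Rightarrow> 0 | Suc j \<Rightarrow> coeff p j) * T ^ i)
                + (\<Sum>i\<le>?n. const (- c) * (const (coeff p i) * T ^ i))"
    by (simp only: cf const_hom(1,2) distrib_right sum.distrib mult.assoc)
  also have "(\<Sum>i\<le>?n. const (case i of 0 \<Rightarrow> 0 | Suc j \<Rightarrow> coeff p j) * T ^ i)
      = (\<Sum>i\<le>degree p. const (coeff p i) * T ^ Suc i)"
    by (subst sum.atMost_Suc_shift) (simp add: const_hom)
  also have "\<dots> = eval_at T p * T"
    by (simp add: eval_at_def sum_distrib_right mult.assoc power_commutes)
  also have "(\<Sum>i\<le>?n. const (- c) * (const (coeff p i) * T ^ i)) = const (- c) * eval_at T p"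
    by (subst ev[of p ?n]) (simp_all only: sum_distrib_left le_SucI le_refl)
  finally show ?thesis
    by (simp only: const_uminus mult_minus_left const_commute[of c "eval_at T p"]
        right_diff_distrib add_uminus_conv_diff)
qed

section \<open>Factorizing the intertwiner\<close>

text \<open>Algebraic form of the statement that \<open>T\<close> has an eigenvector in the solution space of \<open>L\<close>.
  If there were none, the Bezout identities for \<open>L\<close> and \<open>T - c\<close> could be multiplied together,
  one root at a time, to express \<open>1\<close> by \<open>L\<close> and any nonzero polynomial in \<open>T\<close>.\<close>

lemma common_right_divisor_exists:
  assumes L: "L \<noteq> 0" "dop_order L > 0" and LT: "T' * L = L * T"
  shows "\<exists>c G. dop_order G > 0 \<and> rdvd G L \<and> rdvd G (T - const c)"
proof (rule ccontr)
  assume contra: "\<not> ?thesis"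
  have one: "\<exists>U V. 1 = U * L + V * (T - const c)" for c
  proof -
    obtain G U V where G: "G \<noteq> 0" "rdvd G L" "rdvd G (T - const c)"
      and UV: "G = U * L + V * (T - const c)"
      using right_gcd_exists[OF L(1)] by blast
    hence "dop_order G = 0" using contra by auto
    then obtain s where s: "G = scal s" using order_0_scal by blast
    hence "1 = scal (inverse s) * (U * L + V * (T - const c))"
      using G(1) UV scal_inverse(1)[of s] by simp
    also have "\<dots> = (scal (inverse s) * U) * L + (scal (inverse s) * V) * (T - const c)"
      by (simp add: algebra_simps)
    finally show ?thesis by blast
  qed
  have "\<exists>U V. 1 = U * L + V * eval_at T p" if "p \<noteq> 0" for p
    using that
  proof (induction "degree p" arbitrary: p)
    case 0
    then obtain a where a: "p = [:a:]" "a \<noteq> 0" by (metis degree_0_id pCons_0_0)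
    have "const (inverse a) * const a = 1"
      unfolding const_hom(2)[symmetric] using a(2) const_hom(4) by simp
    hence "1 = 0 * L + const (inverse a) * eval_at T p"
      by (simp add: a eval_at_def)
    thus ?case by blast
  next
    case (Suc n)
    obtain c where "poly p c = 0"
      using fundamental_theorem_of_algebra_alt[of p] Suc.hyps(2) Suc.prems
      by (metis degree_pCons_0 nat.distinct(1))
    then obtain r where r: "p = [:- c, 1:] * r" by (meson dvdE poly_eq_0_iff_dvd)
    have "r \<noteq> 0" using Suc.prems r by auto
    hence "degree p = degree r + 1" unfolding r by (subst degree_mult_eq) auto
    hence "n = degree r" using Suc.hyps(2) by simp
    from Suc.hyps(1)[OF this \<open>r \<noteq> 0\<close>]
    obtain U W where UW: "1 = U * L + W * eval_at T r" by blast
    obtain U' V where UV: "1 = U' * L + V * (T - const c)" using one by blast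
    \<comment> \<open>Multiplying the identity for \<open>r\<close> on the right by \<open>T - const c\<close> keeps a left multiple
        of \<open>L\<close>, again by the intertwining relation.\<close>
    have L': "L * (T - const c) = (T' - const c) * L"
      using LT by (simp add: algebra_simps const_commute)
    have "1 = U' * L + V * ((U * L + W * eval_at T r) * (T - const c))"
      by (simp only: UW[symmetric] mult_1_left UV[symmetric])
    also have "\<dots> = (U' + V * U * (T' - const c)) * L + V * W * (eval_at T r * (T - const c))"
      by (simp only: distrib_right distrib_left mult.assoc L' add.assoc)
    finally show ?case unfolding r eval_at_linear_factor by blast
  qed
  moreover obtain p where "p \<noteq> 0" and p: "rdvd L (eval_at T p)"
    using constant_annihilating_poly_exists[OF L(1) LT] by blast
  ultimately obtain U V where UV: "1 = U * L + V * eval_at T p" by blast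
  have "rdvd L 1"
    unfolding UV by (intro rdvd_add rdvd_mult_left rdvd_refl p)
  hence "dop_order L \<le> dop_order 1" by (rule rdvd_order_le) simp
  thus False using L(2) by (simp flip: scal_hom(2))
qed

definition darboux_step :: "dop \<Rightarrow> dop \<Rightarrow> bool" where
  "darboux_step T T1 \<longleftrightarrow>
     (\<exists>A B c. dop_order A = 1 \<and> dop_order B = 1 \<and> T = B * A + const c \<and> T1 = A * B + const c)"

lemma order_eq_pos_nonzero: "dop_order P > 0 \<Longrightarrow> P \<noteq> 0"
  by (auto simp: dop_order_def symbol_hom)

lemma order_add_const: "dop_order P > 0 \<Longrightarrow> dop_order (P + const c) = dop_order P"
  by (simp add: dop_order_def symbol_hom degree_add_eq_left)

lemma darboux_step_order: "darboux_step T T1 \<Longrightarrow> dop_order T = 2 \<and> dop_order T1 = 2"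
  unfolding darboux_step_def using order_eq_pos_nonzero
  by (auto simp: order_mult order_add_const)

text \<open>Splitting off the common right divisor \<open>G\<close> lowers the order of the intertwiner. As \<open>G\<close> divides
  an operator of order two, its order is one or two.\<close>

lemma intertwiner_imp_chain_and_gauge:
  assumes "L \<noteq> 0" "T' * L = L * T" "dop_order T = 2"
  shows "\<exists>T1 s. darboux_step\<^sup>*\<^sup>* T T1 \<and> s \<noteq> 0 \<and> T' * scal s = scal s * T1"
  using assms
proof (induction "dop_order L" arbitrary: L T rule: less_induct)
  case less
  show ?case
  proof (cases "dop_order L = 0")
    case True
    then obtain s where "L = scal s" using order_0_scal by blast
    thus ?thesis using less.prems by (intro exI[of _ T] exI[of _ s]) auto
  next
    case False
    then obtain c G where G: "dop_order G > 0" "rdvd G L" "rdvd G (T - const c)"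
      using common_right_divisor_exists[OF less.prems(1) _ less.prems(2)] by blast
    then obtain L1 B where L1: "L = L1 * G" and B: "T - const c = B * G"
      by (auto simp: rdvd_def)
    have oTc: "dop_order (T - const c) = 2"
      using order_add_const[of T "- c"] less.prems(3) by (simp add: const_uminus)
    have nz: "G \<noteq> 0" "L1 \<noteq> 0" "B \<noteq> 0"
      using G(1) less.prems(1) L1 B oTc order_eq_pos_nonzero[of "T - const c"] by auto
    have oB: "dop_order B + dop_order G = 2" using oTc B nz by (simp add: order_mult)
    have oL: "dop_order L = dop_order L1 + dop_order G" using L1 nz by (simp add: order_mult)
    have T: "T = B * G + const c" using B by (simp add: algebra_simps)
    define T1 where "T1 = G * B + const c"
    have GT: "G * T = T1 * G"
      by (simp add: T T1_def algebra_simps const_commute)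
    have "T' * L1 * G = L1 * T1 * G"
      using less.prems(2) by (simp add: L1 mult.assoc GT)
    hence int: "T' * L1 = L1 * T1" using nz by simp
    have small: "dop_order L1 < dop_order L" using oL G(1) by simp
    show ?thesis
    proof (cases "dop_order G = 1")
      case True
      hence step: "darboux_step T T1"
        using oB T T1_def unfolding darboux_step_def by auto
      obtain T2 s where "darboux_step\<^sup>*\<^sup>* T1 T2" "s \<noteq> 0" "T' * scal s = scal s * T2"
        using less.hyps[OF small nz(2) int] darboux_step_order[OF step] by blast
      thus ?thesis using step by (meson converse_rtranclp_into_rtranclp)
    next
      case False
      hence "dop_order B = 0" "dop_order G = 2" using oB G(1) by auto
      then obtain b where b: "B = scal b" using order_0_scal by blast
      \<comment> \<open>Here \<open>G\<close> is \<open>T - const c\<close> up to a function, and \<open>T1\<close> is a gauge transform of \<open>T\<close>; so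
          an intertwiner of smaller order starts from \<open>T\<close> itself and no chain step is needed.\<close>
      define L2 where "L2 = L1 * scal (inverse b)"
      have b0: "b \<noteq> 0" using nz b by auto
      have "T1 * scal (inverse b) = scal (inverse b) * T"
      proof -
        have "G * scal b * scal (inverse b) = G" "scal (inverse b) * (scal b * G) = G"
          using b0 by (simp_all add: mult.assoc scal_inverse(2)) (simp flip: mult.assoc add: scal_inverse(1))
        thus ?thesis
          by (simp only: T T1_def b distrib_left distrib_right const_commute[of c "scal (inverse b)"])
      qed
      hence "T' * L2 = L2 * T" unfolding L2_def by (metis int mult.assoc)
      moreover have "L2 \<noteq> 0" "dop_order L2 < dop_order L"
        using nz b0 small by (simp_all add: L2_def order_mult)
      ultimately show ?thesis using less.hyps less.prems(3) by blast
    qed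
  qed
qed

text \<open>If \<open>T1 = A B + c\<close> is conjugated by \<open>s\<close>, the factors may be replaced by \<open>s A\<close> and
  \<open>B s\<^sup>-\<^sup>1\<close>; their product in the other order, and hence \<open>T\<close>, does not change.\<close>

lemma darboux_step_gauge:
  assumes "darboux_step T T1" "s \<noteq> 0" "T' * scal s = scal s * T1"
  shows "darboux_step T T'"
proof -
  obtain A B c where AB: "dop_order A = 1" "dop_order B = 1"
    "T = B * A + const c" "T1 = A * B + const c"
    using assms(1) by (auto simp: darboux_step_def)
  let ?A = "scal s * A" and ?B = "B * scal (inverse s)"
  have nz: "A \<noteq> 0" "B \<noteq> 0" using AB order_eq_pos_nonzero by force+
  have "T = ?B * ?A + const c"
    using assms(2) by (metis AB(3) mult.assoc mult_1_right scal_inverse(1))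
  moreover have "T' = ?A * ?B + const c"
  proof -
    have "T' = T' * scal s * scal (inverse s)"
      using assms(2) by (simp add: mult.assoc scal_inverse)
    also have "\<dots> = scal s * (A * B + const c) * scal (inverse s)"
      by (simp add: assms(3) AB)
    also have "\<dots> = ?A * ?B + const c * (scal s * scal (inverse s))"
      by (simp only: distrib_left distrib_right mult.assoc[symmetric] const_commute[of c "scal s"])
    finally show ?thesis using assms(2) by (simp add: scal_inverse)
  qed
  moreover have "dop_order ?A = 1" "dop_order ?B = 1"
    using nz AB assms(2) by (simp_all add: order_mult)
  ultimately show ?thesis unfolding darboux_step_def by blast
qed

section \<open>Translation to maps and conclusion\<close>

lemma Diff_ord_iff: "P \<in> Diff_ord n \<longleftrightarrow> (\<exists>Q. P = act Q \<and> Q \<noteq> 0 \<and> dop_order Q = n)"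
proof
  assume "P \<in> Diff_ord n"
  then obtain a where a: "P = diffop a" "a \<noteq> 0" "degree a = n" by (auto simp: Diff_ord_def)
  have "symbol (Op P) = a"
    by (rule symbol_unique) (simp add: a Op_inverse)
  thus "\<exists>Q. P = act Q \<and> Q \<noteq> 0 \<and> dop_order Q = n"
    using a by (intro exI[of _ "Op P"]) (auto simp: Op_inverse dop_order_def simp flip: symbol_eq_0_iff)
next
  assume "\<exists>Q. P = act Q \<and> Q \<noteq> 0 \<and> dop_order Q = n"
  thus "P \<in> Diff_ord n"
    unfolding Diff_ord_def dop_order_def by (auto simp flip: diffop_symbol)
qed

lemma act_in_Diff_ord: "act Q \<in> Diff_ord n \<longleftrightarrow> Q \<noteq> 0 \<and> dop_order Q = n"
  by (auto simp: Diff_ord_iff act_inject)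

lemma add_op_comp_act: "add_op (act P \<circ> act Q) (const_op c) = act (P * Q + const c)"
  by (simp add: fun_eq_iff add_op_def const_op_def plus_dop.rep_eq times_dop.rep_eq scal.rep_eq)

lemma darboux_connected_act:
  "darboux_connected (act T) (act T') \<longleftrightarrow> (\<exists>L. L \<noteq> 0 \<and> T' * L = L * T)"
proof -
  have "darboux_connected (act T) (act T') \<longleftrightarrow>
      (\<exists>L. act L \<noteq> (\<lambda>_. 0) \<and> act T' \<circ> act L = act L \<circ> act T)"
    unfolding darboux_connected_def by (metis act Op_inverse)
  thus ?thesis by (simp flip: zero_dop.rep_eq times_dop.rep_eq add: act_inject)
qed

lemma gauge_equivalent_act:
  "gauge_equivalent (act T) (act T') \<longleftrightarrow> (\<exists>s. s \<noteq> 0 \<and> T' * scal s = scal s * T)"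
proof -
  have "T' = scal s * T * scal (inverse s) \<longleftrightarrow> T' * scal s = scal s * T" if "s \<noteq> 0" for s
    using that by (metis mult.assoc mult_1_right scal_inverse)
  thus ?thesis
    unfolding gauge_equivalent_def
    by (simp flip: scal.rep_eq times_dop.rep_eq add: act_inject) blast
qed

lemma factorization_chain_connected_act:
  assumes "dop_order T = 2"
  shows "factorization_chain_connected (act T) (act T') \<longleftrightarrow> darboux_step\<^sup>*\<^sup>* T T'"
proof
  assume "factorization_chain_connected (act T) (act T')"
  then obtain n Ts A B lam where Ts: "\<forall>i\<le>n. Ts i \<in> Diff_ord 2" "Ts 0 = act T" "Ts n = act T'"
    and AB: "\<And>i. i < n \<Longrightarrow> A i \<in> Diff_ord 1 \<and> B i \<in> Diff_ord 1 \<and>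
               Ts i = add_op (B i \<circ> A i) (const_op (lam i)) \<and>
               Ts (Suc i) = add_op (A i \<circ> B i) (const_op (lam i))"
    unfolding factorization_chain_connected_def by blast
  have "\<exists>S. Ts i = act S \<and> darboux_step\<^sup>*\<^sup>* T S" if "i \<le> n" for i
    using that
  proof (induction i)
    case 0
    show ?case using Ts by blast
  next
    case (Suc i)
    then obtain S where S: "Ts i = act S" "darboux_step\<^sup>*\<^sup>* T S" by auto
    from Suc.prems have i: "i < n" by simp
    obtain A' B' where A': "A i = act A'" "dop_order A' = 1" and B': "B i = act B'" "dop_order B' = 1"
      using AB[OF i] by (auto simp: Diff_ord_iff)
    have e: "S = B' * A' + const (lam i)" "Ts (Suc i) = act (A' * B' + const (lam i))"
      using AB[OF i] by (simp_all add: S A' B' add_op_comp_act act_inject)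
    have "darboux_step S (A' * B' + const (lam i))"
      unfolding darboux_step_def using e A' B' by blast
    thus ?case using e(2) S(2) by (meson rtranclp.rtrancl_into_rtrancl)
  qed
  thus "darboux_step\<^sup>*\<^sup>* T T'" using Ts(3) by (metis act_inject le_refl)
next
  assume "darboux_step\<^sup>*\<^sup>* T T'"
  then obtain n S where S: "S 0 = T" "S n = T'" and st: "\<forall>i<n. darboux_step (S i) (S (Suc i))"
    by (auto simp: rtranclp_power relpowp_fun_conv)
  have "\<forall>i. \<exists>A B c. i < n \<longrightarrow> dop_order A = 1 \<and> dop_order B = 1 \<and>
          S i = B * A + const c \<and> S (Suc i) = A * B + const c"
    using st unfolding darboux_step_def by blast
  then obtain A B lam where AB: "\<And>i. i < n \<Longrightarrow> dop_order (A i) = 1 \<and> dop_order (B i) = 1 \<and>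
          S i = B i * A i + const (lam i) \<and> S (Suc i) = A i * B i + const (lam i)"
    by metis
  have "dop_order (S i) = 2" if "i \<le> n" for i
  proof (cases i)
    case 0
    thus ?thesis using S(1) assms by simp
  next
    case (Suc j)
    thus ?thesis using st that darboux_step_order by (metis Suc_le_lessD)
  qed
  hence "\<forall>i\<le>n. act (S i) \<in> Diff_ord 2"
    using order_eq_pos_nonzero by (simp add: act_in_Diff_ord)
  moreover have "act (A i) \<in> Diff_ord 1 \<and> act (B i) \<in> Diff_ord 1 \<and>
      act (S i) = add_op (act (B i) \<circ> act (A i)) (const_op (lam i)) \<and>
      act (S (Suc i)) = add_op (act (A i) \<circ> act (B i)) (const_op (lam i))" if "i < n" for i
    using AB[OF that] order_eq_pos_nonzero by (simp add: act_in_Diff_ord add_op_comp_act)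
  ultimately show "factorization_chain_connected (act T) (act T')"
    unfolding factorization_chain_connected_def using S
    by (intro exI[of _ n] exI[of _ "\<lambda>i. act (S i)"] exI[of _ "\<lambda>i. act (A i)"]
        exI[of _ "\<lambda>i. act (B i)"] exI[of _ lam]) simp
qed

text \<open>Each factor \<open>A\<close> of a chain intertwines two consecutive operators, because
  \<open>(A B + c) A = A (B A + c)\<close>; the product of these factors intertwines the ends.\<close>

lemma chain_imp_intertwiner:
  assumes "darboux_step\<^sup>*\<^sup>* T T'"
  shows "\<exists>L. L \<noteq> 0 \<and> T' * L = L * T"
  using assms
proof (induction rule: rtranclp_induct)
  case base
  show ?case by (intro exI[of _ 1]) simp
next
  case (step S S')
  then obtain L where L: "L \<noteq> 0" "S * L = L * T" by blast
  obtain A B c where AB: "dop_order A = 1" "S = B * A + const c" "S' = A * B + const c"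
    using step.hyps(2) by (auto simp: darboux_step_def)
  have "S' * A = A * S" by (simp add: AB algebra_simps const_commute)
  hence "S' * (A * L) = (A * L) * T" by (metis L(2) mult.assoc)
  moreover have "A * L \<noteq> 0" using L(1) AB(1) order_eq_pos_nonzero[of A] by simp
  ultimately show ?case by blast
qed

theorem theorem3p10:
  fixes T T' :: operator
  assumes "T \<in> Diff_ord 2" and "T' \<in> Diff_ord 2"
  shows "darboux_connected T T' \<longleftrightarrow>
           gauge_equivalent T T' \<or> factorization_chain_connected T T'"
proof -
  obtain P P' where P: "T = act P" "dop_order P = 2" and P': "T' = act P'"
    using assms by (auto simp: Diff_ord_iff)
  have "(\<exists>L. L \<noteq> 0 \<and> P' * L = L * P) \<longleftrightarrow>
      (\<exists>s. s \<noteq> 0 \<and> P' * scal s = scal s * P) \<or> darboux_step\<^sup>*\<^sup>* P P'"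
  proof
    assume "\<exists>L. L \<noteq> 0 \<and> P' * L = L * P"
    then obtain S s where S: "darboux_step\<^sup>*\<^sup>* P S" "s \<noteq> 0" "P' * scal s = scal s * S"
      using intertwiner_imp_chain_and_gauge P(2) by blast
    from S(1) show "(\<exists>s. s \<noteq> 0 \<and> P' * scal s = scal s * P) \<or> darboux_step\<^sup>*\<^sup>* P P'"
    proof (cases rule: rtranclp.cases)
      case rtrancl_refl
      thus ?thesis using S by blast
    next
      case (rtrancl_into_rtrancl R)
      thus ?thesis using S darboux_step_gauge by (meson rtranclp.rtrancl_into_rtrancl)
    qed
  next
    assume "(\<exists>s. s \<noteq> 0 \<and> P' * scal s = scal s * P) \<or> darboux_step\<^sup>*\<^sup>* P P'"
    thus "\<exists>L. L \<noteq> 0 \<and> P' * L = L * P"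
      using chain_imp_intertwiner scal_eq_0_iff by blast
  qed
  thus ?thesis
    unfolding P(1) P' darboux_connected_act gauge_equivalent_act
      factorization_chain_connected_act[OF P(2)] .
qed

end
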